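(* Let $T>0$. The piecewise constant (degree $m=0$) convolution B-spline scheme with time step $h$ for the kernel $K(t)=J_0(\omega t)$, where $J_0$ is the Bessel function of the first kind of order zero, is stable for frequency $\omega$ in the contiguous interval $0\le\omega h\le\pi$. Here stable means that the stability coefficients $p_n$ of the scheme satisfy $|p_n|\le C$ for all $n$ such that $nh\le T$, where the constant $C$ is independent of $h$.
   Context: The scheme approximates the Volterra equation $\int_0^tK(t')\,u(t-t')\,dt'=a(t)$, $t\in[0,T]$, with time step $h>0$ and $t_n=nh$. The frequency $\omega$ can be of the order of $1/h$, i.e. $\omega h$ is bounded as $h\to0$ but does not necessarily tend to zero. For degree $m=0$ the basis functions are $\phi_j(\tau)=1$ for $\tau\in[j,j+1)$ and $0$ otherwise ($j\ge0$), so the weights are $q_j=\int_0^\infty K(t)\,\phi_j(t/h)\,dt=\int_{jh}^{(j+1)h}J_0(\omega t)\,dt$, and the scheme is $\sum_{j=0}^nq_j\,v_{n-j}=a(t_n)$ for the unknown coefficients $v_j$. The stability coefficients are defined recursively by $p_0=1$ and $p_n=-\frac1{q_0}\sum_{j=1}^nq_j\,p_{n-j}$ for $n\ge1$. *)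

theory Defs
  imports "HOL-Analysis.Analysis"
begin

definition bessel_J0 :: "real \<Rightarrow> real" where
  "bessel_J0 x = (\<Sum>k. (-1) ^ k / (fact k)\<^sup>2 * (x / 2) ^ (2 * k))"

definition bspline0 :: "nat \<Rightarrow> real \<Rightarrow> real" where
  "bspline0 j \<tau> = (if real j \<le> \<tau> \<and> \<tau> < real j + 1 then 1 else 0)"

definition conv_weight :: "(nat \<Rightarrow> real \<Rightarrow> real) \<Rightarrow> (real \<Rightarrow> real) \<Rightarrow> real \<Rightarrow> nat \<Rightarrow> real" where
  "conv_weight \<phi> K h j = integral {0..} (\<lambda>t. K t * \<phi> j (t / h))"

fun stability_coeff :: "(nat \<Rightarrow> real) \<Rightarrow> nat \<Rightarrow> real" where
  "stability_coeff q n =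
     (if n = 0 then 1 else - (1 / q 0) * (\<Sum>j = 1..n. q j * stability_coeff q (n - j)))"

declare stability_coeff.simps [simp del]

lemma conv_weight_bspline0:
  assumes "h > 0"
  shows "conv_weight bspline0 K h j = integral {real j * h .. (real j + 1) * h} K"
proof -
  have eq: "(if t \<in> {0..} then K t * bspline0 j (t / h) else 0) =
      (if t \<in> {real j * h ..< (real j + 1) * h} then K t else 0)" for t
  proof -
    have "real j \<le> t / h \<longleftrightarrow> real j * h \<le> t" "t / h < real j + 1 \<longleftrightarrow> t < (real j + 1) * h"
      using assms by (simp_all add: pos_le_divide_eq pos_divide_less_eq)
    moreover have "t \<ge> 0" if "real j * h \<le> t"
      using that assms by (meson mult_nonneg_nonneg of_nat_0_le_iff less_imp_le order_trans)
    ultimately show ?thesis by (auto simp: bspline0_def)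
  qed
  have "conv_weight bspline0 K h j = integral {real j * h ..< (real j + 1) * h} K"
    unfolding conv_weight_def
    by (subst (1 2) integral_restrict_UNIV [symmetric]) (simp only: eq)
  also have "\<dots> = integral {real j * h .. (real j + 1) * h} K"
    by (rule integral_subset_negligible)
       (auto intro!: negligible_subset [OF negligible_sing [of "(real j + 1) * h"]])
  finally show ?thesis .
qed

end

(*
  Let Q be the generating function of the weights and P that of the stability coefficients, so
  Q P = q_0. By J_0(x) = (1/pi) int_0^pi cos(x cos theta) d theta, the coefficients
  g_n = q_n + q_(n-1) of (1 + X) Q are (1/pi) int_0^pi 2 cos(n psi h) sin(psi h) / psi d theta
  (half of that for n = 0) with psi = omega cos theta. For |omega h| <= pi the factor
  sin(psi h) / psi is nonnegative, so (1 + X) Q has nonnegative real part on the unit disc.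
  Then so does its reciprocal, and Caratheodory's bound gives at most 2 for the coefficients of
  E = q_0 / ((1 + X) Q); hence those of P = (1 + X) E are at most 4, whatever h and n are.
*)
theory Submission
  imports Defs
begin

unbundle no vec_syntax and fps_syntax

section \<open>The integral representation of \<open>bessel_J0\<close>\<close>

text \<open>Wallis integrals: integrating the derivative of sin \<theta> cos^(2k+1) \<theta>, whose
  boundary values vanish, gives the recursion (2k+2) I_(k+1) = (2k+1) I_k.\<close>

lemma has_integral_cos_power_even:
  "((\<lambda>\<theta>. cos \<theta> ^ (2 * k)) has_integral pi * fact (2 * k) / (4 ^ k * (fact k)\<^sup>2)) {0..pi}"
proof (induction k)
  case 0
  show ?case using has_integral_const_real[of "1::real" 0 pi] by simp
next
  case (Suc k)
  have "((\<lambda>\<theta>. sin \<theta> * cos \<theta> ^ (2 * k + 1)) has_real_derivative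
      (2 * k + 2) * cos \<theta> ^ (2 * Suc k) - (2 * k + 1) * cos \<theta> ^ (2 * k)) (at \<theta> within {0..pi})" for \<theta>
  proof -
    have "cos \<theta> * cos \<theta> ^ (2 * k + 1) + (real (2 * k + 1) * (- sin \<theta> * cos \<theta> ^ (2 * k))) * sin \<theta>
        = cos \<theta> ^ (2 * Suc k) - real (2 * k + 1) * (sin \<theta>)\<^sup>2 * cos \<theta> ^ (2 * k)"
      by (simp add: power2_eq_square)
    also have "\<dots> = (2 * k + 2) * cos \<theta> ^ (2 * Suc k) - (2 * k + 1) * cos \<theta> ^ (2 * k)"
      unfolding sin_squared_eq by (simp add: algebra_simps power2_eq_square)
    finally show ?thesis
      by (intro DERIV_cong[OF DERIV_mult[OF has_field_derivative_at_within[OF DERIV_sin]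
            DERIV_power[OF has_field_derivative_at_within[OF DERIV_cos]]]]) simp
  qed
  then have "((\<lambda>\<theta>. (2 * k + 2) * cos \<theta> ^ (2 * Suc k) - (2 * k + 1) * cos \<theta> ^ (2 * k))
      has_integral sin pi * cos pi ^ (2 * k + 1) - sin 0 * cos 0 ^ (2 * k + 1)) {0..pi}"
    by (intro fundamental_theorem_of_calculus)
       (auto simp: has_real_derivative_iff_has_vector_derivative[symmetric])
  from has_integral_add[OF this has_integral_mult_right[OF Suc.IH, of "2 * k + 1"]]
  have "((\<lambda>\<theta>. (2 * k + 2) * cos \<theta> ^ (2 * Suc k)) has_integral
      (2 * k + 1) * (pi * fact (2 * k) / (4 ^ k * (fact k)\<^sup>2))) {0..pi}"
    by simp
  from has_integral_mult_right[OF this, of "inverse (real (2 * k + 2))"]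
  have "((\<lambda>\<theta>. (inverse (real (2 * k + 2)) * real (2 * k + 2)) * cos \<theta> ^ (2 * Suc k)) has_integral
      inverse (real (2 * k + 2)) * (real (2 * k + 1) * (pi * fact (2 * k) / (4 ^ k * (fact k)\<^sup>2)))) {0..pi}"
    by (simp only: mult.assoc)
  moreover have "inverse (real (2 * k + 2)) * real (2 * k + 2) = 1"
    by (rule left_inverse) simp
  moreover have "inverse (real (2 * k + 2)) * (real (2 * k + 1) * (pi * fact (2 * k) / (4 ^ k * (fact k)\<^sup>2)))
      = pi * fact (2 * Suc k) / (4 ^ Suc k * (fact (Suc k))\<^sup>2)"
    by (simp add: divide_simps power2_eq_square) (simp add: algebra_simps)
  ultimately show ?case by (simp only: mult_1_left)
qed

text \<open>Integrate the cosine series term by term: the Wallis integrals turn the factor 1/(2k)!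
  into 1/(4^k (k!)^2), as in the series of \<open>bessel_J0\<close>.\<close>

lemma bessel_J0_integral:
  "((\<lambda>\<theta>. cos (x * cos \<theta>)) has_integral pi * bessel_J0 x) {0..pi}"
proof -
  define f where "f k \<theta> = (-1) ^ k / fact (2 * k) * (x * cos \<theta>) ^ (2 * k)" for k and \<theta> :: real
  define c where "c k = (-1) ^ k / (fact k)\<^sup>2 * (x / 2) ^ (2 * k)" for k
  have f: "(f k has_integral pi * c k) {0..pi}" for k
  proof -
    have "(x / 2) ^ (2 * k) = x ^ (2 * k) / 4 ^ k"
      by (simp add: power_divide power_mult)
    then have "pi * c k = (-1) ^ k / fact (2 * k) * x ^ (2 * k) *
        (pi * fact (2 * k) / (4 ^ k * (fact k)\<^sup>2))"
      by (simp add: c_def mult_ac)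
    moreover have "f k = (\<lambda>\<theta>. (-1) ^ k / fact (2 * k) * x ^ (2 * k) * cos \<theta> ^ (2 * k))"
      by (simp add: f_def power_mult_distrib fun_eq_iff)
    ultimately show ?thesis
      using has_integral_mult_right[OF has_integral_cos_power_even[of k]] by metis
  qed
  have lim: "uniform_limit {0..pi} (\<lambda>n \<theta>. \<Sum>k<n. f k \<theta>) (\<lambda>\<theta>. \<Sum>k. f k \<theta>) sequentially"
  proof (rule Weierstrass_m_test)
    \<comment> \<open>The majorants are the even-indexed terms of the exponential series at
      \<bar>x\<bar>, free of \<theta>.\<close>
    show "norm (f k \<theta>) \<le> \<bar>x\<bar> ^ (2 * k) / fact (2 * k)" for k \<theta>
    proof -
      have "\<bar>x * cos \<theta>\<bar> ^ (2 * k) \<le> \<bar>x\<bar> ^ (2 * k)"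
        by (intro power_mono) (auto simp: abs_mult intro!: mult_left_le)
      then show ?thesis by (simp add: f_def abs_mult power_abs divide_right_mono)
    qed
    have "summable (\<lambda>n. \<bar>x\<bar> ^ n / fact n)"
      using summable_exp[of "\<bar>x\<bar>"] by (simp add: field_simps)
    then show "summable (\<lambda>k. \<bar>x\<bar> ^ (2 * k) / fact (2 * k))"
      using summable_reindex[of "\<lambda>n. \<bar>x\<bar> ^ n / fact n" "\<lambda>k. 2 * k"] by (simp add: inj_def o_def)
  qed
  have suminf: "(\<Sum>k. f k \<theta>) = cos (x * cos \<theta>)" for \<theta>
    unfolding f_def using cos_paired[of "x * cos \<theta>"] by (simp add: sums_iff)
  have partial: "((\<lambda>\<theta>. \<Sum>k<n. f k \<theta>) has_integral (\<Sum>k<n. pi * c k)) {0..pi}" for n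
    by (intro has_integral_sum f) auto
  \<comment> \<open>These integrals are only asserted to exist; uniqueness then identifies
    \<open>I\<close> with the termwise sums.\<close>
  obtain I J where I: "\<And>n. ((\<lambda>\<theta>. \<Sum>k<n. f k \<theta>) has_integral I n) {0..pi}"
    and J: "((\<lambda>\<theta>. \<Sum>k. f k \<theta>) has_integral J) {0..pi}" and IJ: "I \<longlonglongrightarrow> J"
    by (rule uniform_limit_integral[OF lim])
       (auto simp: f_def intro!: continuous_intros)
  have "I = (\<lambda>n. \<Sum>k<n. pi * c k)"
    by (rule ext) (rule has_integral_unique[OF I partial])
  then have "(\<lambda>k. pi * c k) sums J"
    using IJ by (simp add: sums_def)
  then have "c sums (J / pi)"
    using sums_mult[of "\<lambda>k. pi * c k" J "1 / pi"] by simp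
  then have "J = pi * bessel_J0 x"
    unfolding bessel_J0_def c_def[symmetric] by (simp add: sums_iff)
  then show ?thesis using J by (simp add: suminf)
qed

text \<open>Fubini for a continuous integrand on a rectangle. It makes each weight an average over
  \<theta> of weights for cosine kernels, which are elementary.\<close>

lemma integral_bessel_J0:
  fixes a b \<omega> :: real
  shows "((\<lambda>\<theta>. integral {a..b} (\<lambda>t. cos (\<omega> * t * cos \<theta>))) has_integral
    pi * integral {a..b} (\<lambda>t. bessel_J0 (\<omega> * t))) {0..pi}"
proof -
  have cont: "continuous_on (cbox (0, a) (pi, b)) (\<lambda>(\<theta>, t). cos (\<omega> * t * cos \<theta>))"
    by (auto simp: split_beta intro!: continuous_intros)
  have "integral {0..pi} (\<lambda>\<theta>. integral {a..b} (\<lambda>t. cos (\<omega> * t * cos \<theta>)))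
      = integral {a..b} (\<lambda>t. integral {0..pi} (\<lambda>\<theta>. cos (\<omega> * t * cos \<theta>)))"
    using integral_swap_continuous[OF cont] by simp
  also have "\<dots> = pi * integral {a..b} (\<lambda>t. bessel_J0 (\<omega> * t))"
    by (simp add: integral_unique[OF bessel_J0_integral])
  finally show ?thesis
    using integral_integrable_2dim[OF cont] by (simp add: has_integral_iff)
qed

section \<open>Nonnegative Toeplitz forms and coefficient bounds\<close>

text \<open>The form is \<sigma> times the squared modulus of the sum of w_k e^(ik\<alpha>). The
  triangular sum meets each pair of distinct indices once, hence the factor 2 in \<open>a n\<close>
  for positive \<open>n\<close> only.\<close>

lemma toeplitz_cos_form:
  fixes w :: "nat \<Rightarrow> real"
  assumes "a 0 = \<sigma>" "\<And>n. n > 0 \<Longrightarrow> a n = 2 * \<sigma> * cos (real n * \<alpha>)"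
  shows "(\<Sum>k\<le>n. w k * (\<Sum>j\<le>k. a (k - j) * w j))
    = \<sigma> * ((\<Sum>k\<le>n. w k * cos (real k * \<alpha>))\<^sup>2 + (\<Sum>k\<le>n. w k * sin (real k * \<alpha>))\<^sup>2)"
proof (induction n)
  case 0
  show ?case by (simp add: assms power2_eq_square)
next
  case (Suc n)
  define C S where "C = (\<Sum>k\<le>n. w k * cos (real k * \<alpha>))" and "S = (\<Sum>k\<le>n. w k * sin (real k * \<alpha>))"
  define c s where "c = cos (real (Suc n) * \<alpha>)" and "s = sin (real (Suc n) * \<alpha>)"
  have "(\<Sum>j\<le>n. a (Suc n - j) * w j)
      = (\<Sum>j\<le>n. 2 * \<sigma> * (c * (w j * cos (real j * \<alpha>)) + s * (w j * sin (real j * \<alpha>))))"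
  proof (rule sum.cong)
    fix j assume "j \<in> {..n}"
    then have "real (Suc n - j) * \<alpha> = real (Suc n) * \<alpha> - real j * \<alpha>"
      by (simp add: of_nat_diff algebra_simps)
    then show "a (Suc n - j) * w j
        = 2 * \<sigma> * (c * (w j * cos (real j * \<alpha>)) + s * (w j * sin (real j * \<alpha>)))"
      using \<open>j \<in> {..n}\<close> by (simp only: assms c_def s_def cos_diff) (simp add: assms algebra_simps cos_diff)
  qed simp
  also have "\<dots> = 2 * \<sigma> * (c * C + s * S)"
    by (simp add: C_def S_def sum_distrib_left sum.distrib distrib_left)
  finally have row: "(\<Sum>j\<le>n. a (Suc n - j) * w j) = 2 * \<sigma> * (c * C + s * S)" .
  have cs: "c\<^sup>2 + s\<^sup>2 = 1" by (simp add: c_def s_def)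
  have "(\<Sum>k\<le>Suc n. w k * (\<Sum>j\<le>k. a (k - j) * w j))
      = \<sigma> * (C\<^sup>2 + S\<^sup>2) + w (Suc n) * (2 * \<sigma> * (c * C + s * S) + \<sigma> * w (Suc n))"
    using Suc.IH row by (simp add: C_def S_def assms(1))
  \<comment> \<open>Inserting \<open>cs\<close> into the diagonal term completes both
    squares.\<close>
  also have "\<dots> = \<sigma> * (C\<^sup>2 + S\<^sup>2) + w (Suc n) * (2 * \<sigma> * (c * C + s * S))
      + \<sigma> * (w (Suc n))\<^sup>2 * (c\<^sup>2 + s\<^sup>2)"
    unfolding cs by (simp add: power2_eq_square algebra_simps)
  also have "\<dots> = \<sigma> * ((C + w (Suc n) * c)\<^sup>2 + (S + w (Suc n) * s)\<^sup>2)"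
    by (simp add: power2_eq_square algebra_simps)
  finally show ?case by (simp add: C_def S_def c_def s_def)
qed

lemma fps_mult_nth_atMost: "(F * G) $ n = (\<Sum>j\<le>n. F $ (n - j) * G $ j)"
  for F G :: "real fps"
  by (subst mult.commute, subst fps_mult_nth) (simp only: atLeast0AtMost mult.commute)

text \<open>The hypothesis on the quadratic form encodes that \<open>G\<close> has nonnegative real part on the unit
  disc; the test vector \<open>W = E (1 + s X\<^sup>n)\<close> makes \<open>G W\<close> vanish up to index \<open>n\<close> except at \<open>0\<close>
  and \<open>n\<close>.\<close>

lemma positive_real_inverse_coeff_bound:
  fixes G E :: "real fps"
  assumes pos: "\<And>W n. 0 \<le> (\<Sum>k\<le>n. W $ k * (G * W) $ k)"
    and GE: "G * E = fps_const c" and "c > 0" and E0: "E $ 0 = 1"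
  shows "\<bar>E $ n\<bar> \<le> 2"
proof (cases "n = 0")
  case False
  \<comment> \<open>The two signs of \<open>s\<close> give the two sides of the bound; the 2 arises
    as 1 + s^2, from the indices 0 and \<open>n\<close>.\<close>
  have "0 \<le> s * E $ n + 2" if s: "s * s = 1" for s
  proof -
    define W where "W = E * (1 + fps_const s * fps_X ^ n)"
    have GW: "G * W = fps_const c * (1 + fps_const s * fps_X ^ n)"
      by (simp add: W_def GE flip: mult.assoc)
    have W: "W $ 0 = 1" "W $ n = E $ n + s"
      using False E0 by (simp_all add: W_def distrib_left fps_X_power_mult_right_nth flip: mult.assoc)
    have "0 \<le> (\<Sum>k\<le>n. W $ k * (G * W) $ k)" by (rule pos)
    also have "\<dots> = (\<Sum>k\<in>{0, n}. W $ k * (G * W) $ k)"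
      by (rule sum.mono_neutral_right) (auto simp: GW)
    also have "\<dots> = c * (s * E $ n + 2)"
      using False s by (simp add: GW W algebra_simps)
    finally show ?thesis using \<open>c > 0\<close> by (simp add: zero_le_mult_iff)
  qed
  from this[of 1] this[of "-1"] show ?thesis by simp
qed (simp add: E0)

text \<open>Undoing the factor 1 + X adds two neighbouring coefficients of \<open>E\<close>, each at
  most 2 in modulus; hence the 4.\<close>

lemma stability_coeff_bound:
  fixes q :: "nat \<Rightarrow> real"
  assumes pos: "\<And>W n. 0 \<le> (\<Sum>k\<le>n. W $ k * ((1 + fps_X) * Abs_fps q * W) $ k)"
  shows "\<bar>stability_coeff q n\<bar> \<le> 4"
proof (cases "q 0 = 0")
  case True
  \<comment> \<open>Since 1 / 0 = 0, all coefficients after the initial 1 vanish here.\<close>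
  then show ?thesis by (subst stability_coeff.simps) auto
next
  case False
  have "0 \<le> q 0" using pos[where W = 1 and n = 0] by simp
  with False have q0: "q 0 > 0" by simp
  define P where "P = Abs_fps (stability_coeff q)"
  have P0: "P $ 0 = 1" by (simp add: P_def stability_coeff.simps)
  have QP: "Abs_fps q * P = fps_const (q 0)"
  proof (rule fps_ext)
    fix n
    show "(Abs_fps q * P) $ n = fps_const (q 0) $ n"
    proof (cases "n = 0")
      case n: False
      have "(Abs_fps q * P) $ n = q 0 * stability_coeff q n
          + (\<Sum>j = 1..n. q j * stability_coeff q (n - j))"
        by (simp add: fps_mult_nth P_def sum.atLeast_Suc_atMost)
      also have "\<dots> = 0"
        using n q0 by (subst stability_coeff.simps) simp
      finally show ?thesis using n by simp
    qed (simp add: P0)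
  qed
  define E where "E = P * inverse (1 + fps_X)"
  \<comment> \<open>The constant term 1 makes 1 + X invertible as a formal power series.\<close>
  have inv: "(1 + fps_X) * inverse (1 + fps_X) = (1 :: real fps)"
    by (rule inverse_mult_eq_1') simp
  have E: "\<bar>E $ n\<bar> \<le> 2" for n
  proof (rule positive_real_inverse_coeff_bound[OF pos _ q0])
    have "(1 + fps_X) * Abs_fps q * E = (Abs_fps q * P) * ((1 + fps_X) * inverse (1 + fps_X))"
      by (simp only: E_def mult_ac)
    then show "(1 + fps_X) * Abs_fps q * E = fps_const (q 0)" by (simp add: inv QP)
    show "E $ 0 = 1" by (simp add: E_def P0)
  qed
  have "(1 + fps_X) * E = P * ((1 + fps_X) * inverse (1 + fps_X))" by (simp only: E_def mult_ac)
  then have "P = (1 + fps_X) * E" by (simp add: inv)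
  then have "P $ n = ((1 + fps_X) * E) $ n" by simp
  then have "stability_coeff q n = E $ n + (if n = 0 then 0 else E $ (n - 1))"
    by (simp add: P_def distrib_right)
  then show ?thesis using E[of n] E[of "n - 1"] by (auto split: if_splits)
qed

section \<open>Positivity for the Bessel weights and stability\<close>

theorem mainTheorem5:
  fixes T :: real
  assumes "T > 0"
  shows "\<exists>C. \<forall>h \<omega> :: real. h > 0 \<longrightarrow> 0 \<le> \<omega> * h \<longrightarrow> \<omega> * h \<le> pi \<longrightarrow>
    (\<forall>n. real n * h \<le> T \<longrightarrow>
      \<bar>stability_coeff (conv_weight bspline0 (\<lambda>t. bessel_J0 (\<omega> * t)) h) n\<bar> \<le> C)"
\<comment> \<open>The bound stays schematic until the last \<open>show\<close> fixes it as
  4.\<close>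
proof (intro exI allI impI)
  fix h \<omega> :: real and n :: nat
  assume h: "h > 0" and \<omega>: "0 \<le> \<omega> * h" "\<omega> * h \<le> pi"
  define q where "q = conv_weight bspline0 (\<lambda>t. bessel_J0 (\<omega> * t)) h"
  \<comment> \<open>\<open>A j \<theta>\<close> is the weight for the kernel cos(\<omega> t cos
    \<theta>) with \<theta> frozen; \<open>a\<close> is its counterpart after multiplication by 1 +
    X.\<close>
  define A where "A j \<theta> = integral {real j * h..(real j + 1) * h} (\<lambda>t. cos (\<omega> * t * cos \<theta>))"
    for j \<theta>
  define a where "a j \<theta> = A j \<theta> + (if j = 0 then 0 else A (j - 1) \<theta>)" for j \<theta>
  have A: "(A j has_integral pi * q j) {0..pi}" for j
    unfolding A_def q_def conv_weight_bspline0[OF h] by (rule integral_bessel_J0)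
  define G where "G = (1 + fps_X) * Abs_fps q"
  have G: "G $ j = q j + (if j = 0 then 0 else q (j - 1))" for j
    by (simp add: G_def distrib_right)
  have a: "(a j has_integral pi * G $ j) {0..pi}" for j
    using has_integral_add[OF A[of j] A[of "j - 1"]] A[of j]
    unfolding a_def G by (cases "j = 0") (simp_all add: distrib_left)
  have pointwise: "0 \<le> (\<Sum>k\<le>n. w k * (\<Sum>j\<le>k. a (k - j) \<theta> * w j))" for w :: "nat \<Rightarrow> real" and n \<theta>
  proof -
    define \<psi> where "\<psi> = \<omega> * cos \<theta>"
    \<comment> \<open>The integral of cos(\<psi> t) over [0, h]; the value at \<psi> = 0 is the
      continuous extension.\<close>
    define \<sigma> where "\<sigma> = (if \<psi> = 0 then h else sin (\<psi> * h) / \<psi>)"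
    have A_eq: "A j \<theta> = (if \<psi> = 0 then h else (sin (\<psi> * ((real j + 1) * h)) - sin (\<psi> * (real j * h))) / \<psi>)" for j
    proof (cases "\<psi> = 0")
      case True
      then have "cos (\<omega> * t * cos \<theta>) = 1" for t by (auto simp: \<psi>_def)
      then show ?thesis using True h by (simp add: A_def algebra_simps)
    next
      case False
      have "((\<lambda>t. cos (\<psi> * t)) has_integral
          sin (\<psi> * ((real j + 1) * h)) / \<psi> - sin (\<psi> * (real j * h)) / \<psi>)
          {real j * h..(real j + 1) * h}"
        using False h
        by (intro fundamental_theorem_of_calculus)
           (auto intro!: derivative_eq_intros
             simp: has_real_derivative_iff_has_vector_derivative[symmetric])
      then show ?thesis using False
        by (simp add: A_def \<psi>_def integral_unique mult_ac diff_divide_distrib)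
    qed
    have "a 0 \<theta> = \<sigma>" by (simp add: a_def A_eq \<sigma>_def)
    \<comment> \<open>Adding neighbouring weights merges two cells into one centred at jh, and the
      difference of sines there factors with the fixed amplitude \<sigma>. This is the purpose of 1
      + X.\<close>
    moreover have "a j \<theta> = 2 * \<sigma> * cos (real j * (\<psi> * h))" if "j > 0" for j
    proof -
      have "real j - 1 + 1 = real j" by simp
      moreover have "sin (\<psi> * ((real j + 1) * h)) = sin (real j * (\<psi> * h) + \<psi> * h)"
        "sin (\<psi> * ((real j - 1) * h)) = sin (real j * (\<psi> * h) - \<psi> * h)"
        by (simp_all add: algebra_simps)
      ultimately show ?thesis using that
        by (simp add: a_def A_eq \<sigma>_def of_nat_diff sin_add sin_diff flip: add_divide_distrib)
    qed
    \<comment> \<open>Here \<omega> h \<le> pi enters: it keeps \<bar>\<psi>\<bar> h in [0, pi],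
      where the sine is nonnegative, and sin(\<psi> h) / \<psi> is even in \<psi>.\<close>
    moreover have "\<sigma> \<ge> 0"
    proof -
      have "\<bar>\<psi>\<bar> * h = \<omega> * h * \<bar>cos \<theta>\<bar>"
        using \<omega>(1) h by (simp add: \<psi>_def abs_mult zero_le_mult_iff)
      also have "\<dots> \<le> \<omega> * h" using \<omega>(1) by (intro mult_left_le) auto
      finally have "\<bar>\<psi>\<bar> * h \<le> pi" using \<omega>(2) by simp
      then have "0 \<le> sin (\<bar>\<psi>\<bar> * h) / \<bar>\<psi>\<bar>"
        using h by (intro divide_nonneg_nonneg sin_ge_zero) auto
      then show ?thesis using h by (auto simp: \<sigma>_def abs_if split: if_splits)
    qed
    ultimately show ?thesis
      by (subst toeplitz_cos_form[where \<sigma> = \<sigma> and \<alpha> = "\<psi> * h"]) auto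
  qed
  \<comment> \<open>The form is linear in the Toeplitz coefficients, so its nonnegativity for each
    \<theta> survives integration over \<theta>.\<close>
  have "0 \<le> (\<Sum>k\<le>n. W $ k * (G * W) $ k)" for W n
  proof -
    have "((\<lambda>\<theta>. \<Sum>k\<le>n. W $ k * (\<Sum>j\<le>k. a (k - j) \<theta> * W $ j)) has_integral
        (\<Sum>k\<le>n. W $ k * (\<Sum>j\<le>k. pi * G $ (k - j) * W $ j))) {0..pi}"
      by (intro has_integral_sum has_integral_mult_right has_integral_mult_left a) auto
    then have "0 \<le> (\<Sum>k\<le>n. W $ k * (\<Sum>j\<le>k. pi * G $ (k - j) * W $ j))"
      by (rule has_integral_nonneg) (rule pointwise)
    also have "\<dots> = pi * (\<Sum>k\<le>n. W $ k * (G * W) $ k)"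
      by (simp add: fps_mult_nth_atMost sum_distrib_left mult_ac)
    finally show ?thesis using pi_gt_zero unfolding zero_le_mult_iff by linarith
  qed
  then show "\<bar>stability_coeff (conv_weight bspline0 (\<lambda>t. bessel_J0 (\<omega> * t)) h) n\<bar> \<le> 4"
    unfolding q_def[symmetric] G_def by (rule stability_coeff_bound)
qed

end
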